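(* The mapping $n\mapsto s_n$ is a bijection from $\mathbb{N}=\{0,1,2,\dots\}$ to the set $\mathbb{Q}_+$ of non-negative rational numbers.
   Context: Define triples of integers $N_n=(a_n;b_n;c_n)$ for every integer $n\geqslant 1$ as the labels of the vertices of a quinary tree $\mathcal{A}_5$ read from the top and, at each level, from left to right. The top is $N_1=(1;3;0)$. For every $n\geqslant 1$, the first, second, third, fourth and fifth children of $N_n=(a;b;c)$ are respectively $N_{5n-3}$, $N_{5n-2}$, $N_{5n-1}$, $N_{5n}$, $N_{5n+1}$, and they are given by: - if $3\nmid b$: $N_{5n-3}=(3(4c+3)a-2b;\,3(6c+5)a-3b;\,0)$, $N_{5n-2}=((6c+5)a-b;\,6(c+1)a-b;\,0)$, $N_{5n-1}=(6(c+1)a-b;\,3a;\,0)$, $N_{5n}=(a;\,3a+b;\,c+1)$, $N_{5n+1}=(3a+b;\,6a+3b;\,0)$; - if $3\mid b$: $N_{5n-3}=((4c+3)a-\frac{2b}{3};\,(6c+5)a-b;\,0)$, $N_{5n-2}=((6c+5)a-b;\,6(c+1)a-b;\,0)$, $N_{5n-1}=(2(c+1)a-\frac{b}{3};\,a;\,0)$, $N_{5n}=(a;\,3a+b;\,c+1)$, $N_{5n+1}=(a+\frac{b}{3};\,2a+b;\,0)$. The sequence $(s_n)_{n\in\mathbb{N}}$ is defined by $s_0=0$ and $s_n=\frac{a_n}{b_n}$ for every $n\geqslant 1$. *)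

theory Defs
  imports Complex_Main
begin

text \<open>
  The label of the child number \<open>i\<close> (counted from 0, left to right) of a vertex of the quinary
  tree labelled \<open>(a; b; c)\<close>. All occurrences of \<open>div 3\<close> are exact, as they are guarded by
  \<open>3 dvd b\<close>.
\<close>

fun child_label :: "nat \<Rightarrow> int \<times> int \<times> int \<Rightarrow> int \<times> int \<times> int" where
  "child_label i (a, b, c) =
    (if \<not> 3 dvd b then
       (if i = 0 then (3 * (4*c + 3) * a - 2*b, 3 * (6*c + 5) * a - 3*b, 0)
        else if i = 1 then ((6*c + 5) * a - b, 6 * (c + 1) * a - b, 0)
        else if i = 2 then (6 * (c + 1) * a - b, 3*a, 0)
        else if i = 3 then (a, 3*a + b, c + 1)
        else (3*a + b, 6*a + 3*b, 0))
     else
       (if i = 0 then ((4*c + 3) * a - (2*b) div 3, (6*c + 5) * a - b, 0)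
        else if i = 1 then ((6*c + 5) * a - b, 6 * (c + 1) * a - b, 0)
        else if i = 2 then (2 * (c + 1) * a - b div 3, a, 0)
        else if i = 3 then (a, 3*a + b, c + 1)
        else (a + b div 3, 2*a + b, 0)))"

text \<open>
  The vertices are numbered from 1, and the children of vertex \<open>n\<close> are the vertices
  \<open>5 * n - 3, \<dots>, 5 * n + 1\<close>; thus vertex \<open>m > 1\<close> is the child number \<open>(m + 3) mod 5\<close> of
  vertex \<open>(m + 3) div 5\<close>. The value at 0 is a dummy, as there is no vertex 0.
\<close>

function N_label :: "nat \<Rightarrow> int \<times> int \<times> int" where
  "N_label n =
    (if n \<le> 1 then (1, 3, 0)
     else child_label ((n + 3) mod 5) (N_label ((n + 3) div 5)))"
  by pat_completeness auto
termination by (relation "measure id") auto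

declare N_label.simps [simp del]

lemma N_label_1: "N_label 1 = (1, 3, 0)"
  by (simp add: N_label.simps)

lemma N_label_child:
  assumes "n \<ge> 1" and "i < 5"
  shows "N_label (5 * n - 3 + i) = child_label i (N_label n)"
proof -
  have "5 * n - 3 + i + 3 = i + n * 5"
    using assms by simp
  moreover have "(i + n * 5) mod 5 = i" "(i + n * 5) div 5 = n"
    using assms by simp_all
  moreover have "\<not> 5 * n - 3 + i \<le> 1"
    using assms by simp
  ultimately show ?thesis
    by (subst N_label.simps) simp
qed

definition s_seq :: "nat \<Rightarrow> rat" where
  "s_seq n =
    (if n = 0 then 0
     else case N_label n of (a, b, c) \<Rightarrow> of_int a / of_int b)"

end

theory Submission
  imports Defs
begin

text \<open>
  Replace \<open>s = a / b\<close> by its inverse \<open>y = b / a\<close>. The case distinction on \<open>3 dvd b\<close> only cancels a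
  common factor 3 from \<open>a\<close> and \<open>b\<close>, and at every vertex \<open>c = \<lceil>y / 3\<rceil> - 1\<close>, because \<open>c\<close> counts
  how often the step \<open>y \<mapsto> y + 3\<close> was made since \<open>y\<close> last lay in \<open>(0, 3]\<close>. Hence the children's
  ratios are five functions of \<open>y\<close> alone (\<open>child_label_coherent\<close>). With \<open>r = 6 * (c + 1) - y\<close> they
  are \<open>3 * (r - 1) / (2 * r - 3)\<close>, \<open>r / (r - 1)\<close>, \<open>3 / r\<close>, \<open>y + 3\<close> and
  \<open>(6 + 3 * y) / (3 + y)\<close>.

  The map from \<open>y\<close> to \<open>r\<close> is a bijection from the positive rationals to the rationals \<open>\<ge> 3\<close>. So the
  five functions map the positive rationals bijectively onto the rational points of
  \<open>(3/2, 2]\<close>, \<open>(1, 3/2]\<close>, \<open>(0, 1]\<close>, \<open>(3, \<infinity>)\<close> and \<open>(2, 3)\<close>, which together are all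
  positive rationals except the root's ratio 3. Therefore every positive \<open>y \<noteq> 3\<close> has exactly one possible
  parent and one possible position below it (\<open>branch_of_branch\<close>, \<open>parent_branch\<close>,
  \<open>branch_parent\<close>). Induction on the vertex number then shows that no ratio occurs twice.

  Every positive rational occurs because passing to the parent terminates at 3. Subtracting 3
  brings \<open>y\<close> into \<open>(0, 3]\<close>, and for \<open>y < 3\<close> the parent has a smaller weight, where \<open>p / q\<close> weighs
  \<open>3 * q\<^sup>2\<close> and \<open>3 * p / q\<close> weighs \<open>q\<^sup>2\<close> (\<open>weight_parent_less\<close>). The weight does not
  change under \<open>y \<mapsto> y - 3\<close>, so the two kinds of steps combine to a terminating descent.
\<close>

section \<open>The tree on ratios\<close>

text \<open>
  Writing \<open>y = 3 * c + u\<close> with \<open>c\<close> an integer and \<open>0 < u \<le> 3\<close>, this is \<open>6 * (c + 1) - y = 3 * c + 6 - u\<close>.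
  It turns the cell \<open>(3 * c, 3 * c + 3]\<close> around and moves it to \<open>[3 * c + 3, 3 * c + 6)\<close>; these
  target cells tile the rationals, so no information is lost.
\<close>

definition reflect :: "rat \<Rightarrow> rat" where
  "reflect y = 6 * of_int \<lceil>y / 3\<rceil> - y"

definition unreflect :: "rat \<Rightarrow> rat" where
  "unreflect v = 6 * of_int \<lfloor>v / 3\<rfloor> - v"

lemma reflect_ge_3:
  assumes "0 < y"
  shows "3 \<le> reflect y"
proof -
  have "1 \<le> \<lceil>y / 3\<rceil>"
    using assms by linarith
  then have "(1 :: rat) \<le> of_int \<lceil>y / 3\<rceil>"
    by simp
  moreover have "y / 3 \<le> of_int \<lceil>y / 3\<rceil>"
    by (rule le_of_int_ceiling)
  ultimately show ?thesis
    unfolding reflect_def by linarith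
qed

lemma unreflect_pos:
  assumes "3 \<le> v"
  shows "0 < unreflect v"
proof -
  have "1 \<le> \<lfloor>v / 3\<rfloor>"
    using assms by linarith
  then have "(1 :: rat) \<le> of_int \<lfloor>v / 3\<rfloor>"
    by simp
  moreover have "v / 3 < of_int \<lfloor>v / 3\<rfloor> + 1"
    by linarith
  ultimately show ?thesis
    unfolding unreflect_def by linarith
qed

lemma unreflect_reflect: "unreflect (reflect y) = y"
proof -
  have "\<lfloor>reflect y / 3\<rfloor> = \<lceil>y / 3\<rceil>"
    unfolding reflect_def by (rule floor_unique) (simp_all add: field_simps, linarith+)
  then show ?thesis
    by (simp add: unreflect_def reflect_def)
qed

lemma reflect_unreflect: "reflect (unreflect v) = v"
proof -
  have "\<lceil>unreflect v / 3\<rceil> = \<lfloor>v / 3\<rfloor>"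
    unfolding unreflect_def by (rule ceiling_unique) (simp_all add: field_simps, linarith+)
  then show ?thesis
    by (simp add: unreflect_def reflect_def)
qed

definition branch :: "nat \<Rightarrow> rat \<Rightarrow> rat" where
  "branch i y =
    (if i = 0 then 3 * (reflect y - 1) / (2 * reflect y - 3)
     else if i = 1 then reflect y / (reflect y - 1)
     else if i = 2 then 3 / reflect y
     else if i = 3 then y + 3
     else (6 + 3 * y) / (3 + y))"

text \<open>
  The branches are not ordered by their ranges: from left to right, the ranges belong to the branches
  2, 1, 0, 4 and 3. The value 3 on the border of the last two belongs to the root and is in no range.
\<close>

definition branch_of :: "rat \<Rightarrow> nat" where
  "branch_of y =
    (if y \<le> 1 then 2 else if y \<le> 3/2 then 1 else if y \<le> 2 then 0 else if y < 3 then 4 else 3)"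

definition parent :: "rat \<Rightarrow> rat" where
  "parent y =
    (if y \<le> 1 then unreflect (3 / y)
     else if y \<le> 3/2 then unreflect (y / (y - 1))
     else if y \<le> 2 then unreflect (3 * (y - 1) / (2 * y - 3))
     else if y < 3 then 3 * (y - 2) / (3 - y)
     else y - 3)"

text \<open>
  Each of the first three branches is a decreasing function of \<open>reflect y\<close>, which is at least 3;
  the value at 3 and the limit at infinity are the endpoints of its range.
\<close>

lemma branch_of_branch:
  assumes "i < 5" and "0 < y"
  shows "branch_of (branch i y) = i"
proof -
  have r: "3 \<le> reflect y"
    using assms(2) by (rule reflect_ge_3)
  consider "i = 0" | "i = 1" | "i = 2" | "i = 3" | "i = 4"
    using assms(1) by linarith
  then show ?thesis
    using r assms(2) by cases (simp_all add: branch_def branch_of_def field_simps)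
qed

lemma parent_branch:
  assumes "i < 5" and "0 < y"
  shows "parent (branch i y) = y"
proof -
  define r where "r = reflect y"
  have u: "unreflect r = y"
    by (simp add: r_def unreflect_reflect)
  have r3: "3 \<le> r"
    unfolding r_def using assms(2) by (rule reflect_ge_3)
  consider "i = 0" | "i = 1" | "i = 2" | "i = 3" | "i = 4"
    using assms(1) by linarith
  then show ?thesis
  proof cases
    case 1
    define z where "z = 3 * (r - 1) / (2 * r - 3)"
    have "3/2 < z" "z \<le> 2"
      using r3 by (simp_all add: z_def field_simps)
    moreover have "3 * (z - 1) / (2 * z - 3) = r"
      using r3 by (simp add: z_def divide_simps)
    ultimately have "parent z = y"
      using u by (simp add: parent_def)
    then show ?thesis
      using 1 by (simp add: branch_def r_def z_def)
  next
    case 2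
    define z where "z = r / (r - 1)"
    have "1 < z" "z \<le> 3/2"
      using r3 by (simp_all add: z_def field_simps)
    moreover have "z / (z - 1) = r"
      using r3 by (simp add: z_def divide_simps)
    ultimately show ?thesis
      using u 2 by (simp add: branch_def parent_def r_def[symmetric] z_def[symmetric])
  next
    case 3
    then show ?thesis
      using u r3 by (simp add: branch_def parent_def r_def[symmetric])
  next
    case 4
    then show ?thesis
      using assms(2) by (simp add: branch_def parent_def)
  next
    case 5
    define z where "z = (6 + 3 * y) / (3 + y)"
    have "2 < z" "z < 3"
      using assms(2) by (simp_all add: z_def field_simps)
    moreover have "3 * (z - 2) / (3 - z) = y"
      using assms(2) by (simp add: z_def divide_simps)
    ultimately show ?thesis
      using 5 by (simp add: branch_def parent_def z_def[symmetric])
  qed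
qed

lemma branch_neq_root:
  assumes "i < 5" and "0 < y"
  shows "branch i y \<noteq> 3"
proof
  assume root: "branch i y = 3"
  have "i = 3"
    using branch_of_branch[OF assms] by (simp add: root branch_of_def)
  with root assms(2) show False
    by (simp add: branch_def)
qed

lemma branch_parent:
  assumes "0 < y"
  shows "branch (branch_of y) (parent y) = y"
proof -
  consider "y \<le> 1" | "1 < y" "y \<le> 3/2" | "3/2 < y" "y \<le> 2" | "2 < y" "y < 3" | "3 \<le> y"
    by linarith
  then show ?thesis
    using assms
    by cases (simp_all add: branch_def branch_of_def parent_def reflect_unreflect field_simps)
qed

lemma branch_of_less: "branch_of y < 5"
  by (simp add: branch_of_def)

lemma parent_pos:
  assumes "0 < y" and "y < 3"
  shows "0 < parent y"
  using assms by (auto simp: parent_def field_simps intro!: unreflect_pos)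

section \<open>A weight that decreases towards the root\<close>

text \<open>
  Fractions need not be reduced, so a number has many weights; any one of them can start the descent.
  The denominator alone would not decrease: the parent of \<open>2 / 1\<close> is \<open>3 / 1\<close>. Favouring numerators
  that are multiples of 3 fits the inversion \<open>y \<mapsto> 3 / y\<close> that underlies the branches, as it
  exchanges the two shapes \<open>p / q\<close> and \<open>3 * p / q\<close>.
\<close>

definition has_weight :: "rat \<Rightarrow> int \<Rightarrow> bool" where
  "has_weight y w \<longleftrightarrow>
    (\<exists>p q. 0 < q \<and>
      (y = of_int p / of_int q \<and> w = 3 * q\<^sup>2 \<or> y = of_int (3 * p) / of_int q \<and> w = q\<^sup>2))"

lemma has_weight_plainI: "0 < q \<Longrightarrow> y * of_int q = of_int p \<Longrightarrow> has_weight y (3 * q\<^sup>2)"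
  unfolding has_weight_def by (intro exI[of _ p] exI[of _ q]) (simp add: field_simps)

lemma has_weight_tripleI: "0 < q \<Longrightarrow> y * of_int q = of_int (3 * p) \<Longrightarrow> has_weight y (q\<^sup>2)"
  unfolding has_weight_def by (intro exI[of _ p] exI[of _ q]) (simp add: field_simps)

lemma has_weight_cases:
  assumes "has_weight y w"
  obtains (plain) p q where "0 < q" "y = of_int p / of_int q" "w = 3 * q\<^sup>2"
    | (triple) p q where "0 < q" "y = 3 * of_int p / of_int q" "w = q\<^sup>2"
  using assms unfolding has_weight_def by fastforce

lemma has_weight_reflection:
  assumes "has_weight y w"
  shows "has_weight (6 * of_int k - y) w"
  using assms
proof (cases rule: has_weight_cases)
  case (plain p q)
  then show ?thesis
    using has_weight_plainI[of q "6 * of_int k - y" "6 * k * q - p"] by (simp add: field_simps)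
next
  case (triple p q)
  then show ?thesis
    using has_weight_tripleI[of q "6 * of_int k - y" "2 * k * q - p"] by (simp add: field_simps)
qed

lemma has_weight_shift:
  assumes "has_weight y w"
  shows "has_weight (y - 3 * of_nat k) w"
  using assms
proof (cases rule: has_weight_cases)
  case (plain p q)
  then show ?thesis
    using has_weight_plainI[of q "y - 3 * of_nat k" "p - 3 * int k * q"] by (simp add: field_simps)
next
  case (triple p q)
  then show ?thesis
    using has_weight_tripleI[of q "y - 3 * of_nat k" "p - int k * q"] by (simp add: field_simps)
qed

lemma has_weight_unreflect: "has_weight v w \<Longrightarrow> has_weight (unreflect v) w"
  unfolding unreflect_def by (rule has_weight_reflection)

lemma
  fixes y :: rat
  assumes "0 < q" and "y = of_int p / of_int q"
  shows quotient_le_iff: "0 < n \<Longrightarrow> y \<le> of_int m / of_int n \<longleftrightarrow> p * n \<le> m * q"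
    and quotient_less_iff: "0 < n \<Longrightarrow> y < of_int m / of_int n \<longleftrightarrow> p * n < m * q"
    and less_quotient_iff: "0 < n \<Longrightarrow> of_int m / of_int n < y \<longleftrightarrow> m * q < p * n"
  using assms(1) unfolding assms(2) by (simp_all add: divide_simps flip: of_int_mult)

text \<open>
  The number \<open>v\<close> is the parent of \<open>y\<close>, up to an application of \<open>unreflect\<close> in the first three cases. Each
  equation has the form \<open>v * e = f\<close> with \<open>e\<close> and \<open>f\<close> affine in \<open>y\<close>, so a denominator \<open>q\<close> of \<open>y\<close> gives
  the denominator \<open>e * q\<close> of \<open>v\<close>, and the bounds on \<open>y\<close> limit \<open>e\<close>. In the second case \<open>e \<le> 1/2\<close>, and
  a factor 3 in the numerator persists. The other equations exchange the two shapes of fractions.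
  If \<open>y = p / q\<close>, then \<open>f * q\<close> is a multiple of 3, so that \<open>e \<le> 1\<close> is enough. If \<open>y = 3 * p / q\<close>,
  then 3 cancels, and the denominator \<open>e * q / 3\<close> is at most \<open>q / 3\<close>, which
  outweighs the lost factor 3 in the numerator.
\<close>

lemma weight_decreases:
  assumes "has_weight y w" and "0 < y"
    and "y \<le> 1 \<and> v * y = 3 \<or>
      1 < y \<and> y \<le> 3/2 \<and> v * (y - 1) = y \<or>
      3/2 < y \<and> y \<le> 2 \<and> v * (2 * y - 3) = 3 * (y - 1) \<or>
      2 < y \<and> y < 3 \<and> v * (3 - y) = 3 * (y - 2)"
  shows "\<exists>w'. has_weight v w' \<and> w' < w"
proof -
  have less: "d\<^sup>2 < q\<^sup>2" if "0 < d" "d < q" for d q :: int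
    using that by (simp add: power_strict_mono)
  have less_triple: "3 * d\<^sup>2 < q\<^sup>2" if "0 < d" "3 * d \<le> q" for d q :: int
  proof -
    have "(3 * d)\<^sup>2 \<le> q\<^sup>2"
      using that by (intro power_mono) auto
    then have "9 * d\<^sup>2 \<le> q\<^sup>2"
      by (simp add: power_mult_distrib)
    then show ?thesis
      using zero_less_power[OF that(1), of 2] by linarith
  qed
  have less_third: "d\<^sup>2 < 3 * q\<^sup>2" if "0 < d" "d \<le> q" for d q :: int
    using that power_mono[of d q 2] zero_less_power[of q 2] by linarith
  have less_scaled: "3 * d\<^sup>2 < 3 * q\<^sup>2" if "0 < d" "d < q" for d q :: int
    using less[OF that] by simp
  have scale: "v * of_int d = g"
    if "v * e = f" "e * of_int q = of_int d" "f * of_int q = g" for d q e f g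
    using that by (metis mult.assoc)
  from assms(1) show ?thesis
  proof (cases rule: has_weight_cases)
    case (plain p q)
    have y: "y = of_int p / of_int q"
      using plain(2) by simp
    then have yq: "y * of_int q = of_int p"
      using plain(1) by simp
    from assms(3) consider
        "0 < y" "y \<le> 1" "v * y = 3" | "1 < y" "y \<le> 3/2" "v * (y - 1) = y"
      | "3/2 < y" "y \<le> 2" "v * (2 * y - 3) = 3 * (y - 1)"
      | "2 < y" "y < 3" "v * (3 - y) = 3 * (y - 2)"
      using assms(2) by blast
    then show ?thesis
    proof cases
      case 1
      have d: "0 < p" "p \<le> q"
        using 1(1,2) plain(1) less_quotient_iff[OF plain(1) y, of 1 0]
          quotient_le_iff[OF plain(1) y, of 1 1]
        by simp_all
      have "has_weight v (p\<^sup>2)"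
        by (rule has_weight_tripleI[where p = q, OF d(1) scale[where q = q, OF 1(3)]])
          (simp_all add: left_diff_distrib mult.assoc yq)
      then show ?thesis
        using less_third[OF d] plain(3) by blast
    next
      case 2
      have d: "0 < p - q" "p - q < q"
        using 2(1,2) plain(1) less_quotient_iff[OF plain(1) y, of 1 1]
          quotient_le_iff[OF plain(1) y, of 2 3]
        by simp_all
      have "has_weight v (3 * (p - q)\<^sup>2)"
        by (rule has_weight_plainI[where p = p, OF d(1) scale[where q = q, OF 2(3)]])
          (simp_all add: left_diff_distrib mult.assoc yq)
      then show ?thesis
        using less_scaled[OF d] plain(3) by blast
    next
      case 3
      have d: "0 < 2 * p - 3 * q" "2 * p - 3 * q \<le> q"
        using 3(1,2) plain(1) less_quotient_iff[OF plain(1) y, of 2 3]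
          quotient_le_iff[OF plain(1) y, of 1 2]
        by simp_all
      have "has_weight v ((2 * p - 3 * q)\<^sup>2)"
        by (rule has_weight_tripleI[where p = "p - q", OF d(1) scale[where q = q, OF 3(3)]])
          (simp_all add: left_diff_distrib mult.assoc yq)
      then show ?thesis
        using less_third[OF d] plain(3) by blast
    next
      case 4
      have d: "0 < 3 * q - p" "3 * q - p \<le> q"
        using 4(1,2) plain(1) less_quotient_iff[OF plain(1) y, of 1 2]
          quotient_less_iff[OF plain(1) y, of 1 3]
        by simp_all
      have "has_weight v ((3 * q - p)\<^sup>2)"
        by (rule has_weight_tripleI[where p = "p - 2 * q", OF d(1) scale[where q = q, OF 4(3)]])
          (simp_all add: left_diff_distrib mult.assoc yq)
      then show ?thesis
        using less_third[OF d] plain(3) by blast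
    qed
  next
    case (triple p q)
    have y: "y = of_int (3 * p) / of_int q"
      using triple(2) by simp
    then have yq: "y * of_int q = of_int (3 * p)"
      using triple(1) by simp
    have scale_triple: "v * of_int d = g"
      if "v * e = f" "e * of_int q = 3 * of_int d" "f * of_int q = 3 * g" for d e f g
    proof -
      have "3 * (v * of_int d) = 3 * g"
        using that by (metis mult.assoc mult.left_commute)
      then show ?thesis
        by simp
    qed
    from assms(3) consider
        "0 < y" "y \<le> 1" "v * y = 3" | "1 < y" "y \<le> 3/2" "v * (y - 1) = y"
      | "3/2 < y" "y \<le> 2" "v * (2 * y - 3) = 3 * (y - 1)"
      | "2 < y" "y < 3" "v * (3 - y) = 3 * (y - 2)"
      using assms(2) by blast
    then show ?thesis
    proof cases
      case 1
      have d: "0 < p" "3 * p \<le> q"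
        using 1(1,2) triple(1) less_quotient_iff[OF triple(1) y, of 1 0]
          quotient_le_iff[OF triple(1) y, of 1 1]
        by simp_all
      have "has_weight v (3 * p\<^sup>2)"
        by (rule has_weight_plainI[where p = q, OF d(1) scale_triple[OF 1(3)]])
          (simp_all add: left_diff_distrib mult.assoc yq)
      then show ?thesis
        using less_triple[OF d] triple(3) by blast
    next
      case 2
      have d: "0 < 3 * p - q" "3 * p - q < q"
        using 2(1,2) triple(1) less_quotient_iff[OF triple(1) y, of 1 1]
          quotient_le_iff[OF triple(1) y, of 2 3]
        by simp_all
      have "has_weight v ((3 * p - q)\<^sup>2)"
        by (rule has_weight_tripleI[where p = p, OF d(1) scale[where q = q, OF 2(3)]])
          (simp_all add: left_diff_distrib mult.assoc yq)
      then show ?thesis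
        using less[OF d] triple(3) by blast
    next
      case 3
      have d: "0 < 2 * p - q" "3 * (2 * p - q) \<le> q"
        using 3(1,2) triple(1) less_quotient_iff[OF triple(1) y, of 2 3]
          quotient_le_iff[OF triple(1) y, of 1 2]
        by simp_all
      have "has_weight v (3 * (2 * p - q)\<^sup>2)"
        by (rule has_weight_plainI[where p = "3 * p - q", OF d(1) scale_triple[OF 3(3)]])
          (simp_all add: left_diff_distrib mult.assoc yq)
      then show ?thesis
        using less_triple[OF d] triple(3) by blast
    next
      case 4
      have d: "0 < q - p" "3 * (q - p) \<le> q"
        using 4(1,2) triple(1) less_quotient_iff[OF triple(1) y, of 1 2]
          quotient_less_iff[OF triple(1) y, of 1 3]
        by simp_all
      have "has_weight v (3 * (q - p)\<^sup>2)"
        by (rule has_weight_plainI[where p = "3 * p - 2 * q", OF d(1) scale_triple[OF 4(3)]])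
          (simp_all add: left_diff_distrib mult.assoc yq)
      then show ?thesis
        using less_triple[OF d] triple(3) by blast
    qed
  qed
qed

lemma weight_parent_less:
  assumes "has_weight y w" and "0 < y" and "y < 3"
  shows "\<exists>w'. has_weight (parent y) w' \<and> w' < w"
proof -
  define v where "v =
    (if y \<le> 1 then 3 / y else if y \<le> 3/2 then y / (y - 1)
     else if y \<le> 2 then 3 * (y - 1) / (2 * y - 3) else 3 * (y - 2) / (3 - y))"
  have "parent y = (if y \<le> 2 then unreflect v else v)"
    using assms(3) by (simp add: parent_def v_def)
  moreover have "\<exists>w'. has_weight v w' \<and> w' < w"
    by (rule weight_decreases[OF assms(1,2)]) (use assms(2,3) in \<open>auto simp: v_def\<close>)
  ultimately show ?thesis
    using has_weight_unreflect by auto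
qed

section \<open>Labels\<close>

definition label_ratio :: "int \<times> int \<times> int \<Rightarrow> rat" where
  "label_ratio = (\<lambda>(a, b, c). of_int b / of_int a)"

text \<open>
  Due to the equation for \<open>c\<close>, the ratio of a child is a function of the ratio of its parent.
\<close>

definition coherent :: "int \<times> int \<times> int \<Rightarrow> bool" where
  "coherent = (\<lambda>(a, b, c). 0 < a \<and> 0 < b \<and> c + 1 = \<lceil>label_ratio (a, b, c) / 3\<rceil>)"

text \<open>
  Both cases of \<open>child_label\<close> give the same pair up to a positive factor \<open>m\<close>, and the entries of the
  list are the values of \<open>branch\<close> with denominators cleared: \<open>r\<close> is \<open>a\<close> times the reflected ratio.
\<close>

lemma child_label_up_to_factor:
  fixes a b c :: int
  assumes "i < 5"
  defines "r \<equiv> 6 * (c + 1) * a - b"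
  obtains m a' b' where "0 < m"
    and "child_label i (a, b, c) = (a', b', if i = 3 then c + 1 else 0)"
    and "(m * a', m * b') =
      [(2 * r - 3 * a, 3 * (r - a)), (r - a, r), (r, 3 * a), (a, b + 3 * a),
       (3 * a + b, 6 * a + 3 * b)] ! i"
proof -
  have i: "i = 0 \<or> i = 1 \<or> i = 2 \<or> i = 3 \<or> i = 4"
    using assms(1) by linarith
  \<comment> \<open>The children at even positions are those from which a factor 3 is cancelled.\<close>
  define m :: int where "m = (if 3 dvd b \<and> even i then 3 else 1)"
  obtain a' b' where ab: "child_label i (a, b, c) = (a', b', if i = 3 then c + 1 else 0)"
    using i by (cases "child_label i (a, b, c)") (auto split: if_splits)
  have "(m * a', m * b') =
      [(2 * r - 3 * a, 3 * (r - a)), (r - a, r), (r, 3 * a), (a, b + 3 * a),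
       (3 * a + b, 6 * a + 3 * b)] ! i"
  proof (cases "3 dvd b")
    case True
    then obtain k where "b = 3 * k" ..
    then show ?thesis
      using i ab by (elim disjE) (auto simp: m_def r_def algebra_simps)
  next
    case False
    then show ?thesis
      using i ab by (elim disjE) (auto simp: m_def r_def algebra_simps)
  qed
  moreover have "0 < m"
    by (simp add: m_def)
  ultimately show ?thesis
    using ab that by blast
qed

lemma child_label_coherent:
  assumes "coherent L" and "i < 5"
  shows "coherent (child_label i L) \<and> label_ratio (child_label i L) = branch i (label_ratio L)"
proof -
  obtain a b c where L: "L = (a, b, c)"
    by (cases L)
  define y where "y = label_ratio L"
  have "0 < a" "0 < b" and c: "c + 1 = \<lceil>y / 3\<rceil>" and y: "y = of_int b / of_int a"
    using assms(1) by (simp_all add: coherent_def y_def L label_ratio_def)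
  then have "0 < y"
    by simp
  define r where "r = 6 * (c + 1) * a - b"
  have refl: "reflect y = of_int r / of_int a"
    using \<open>0 < a\<close> unfolding reflect_def c[symmetric] by (simp add: y r_def field_simps)
  then have "of_int (3 * a) \<le> (of_int r :: rat)"
    using reflect_ge_3[OF \<open>0 < y\<close>] \<open>0 < a\<close> by (simp add: le_divide_eq)
  then have "3 * a \<le> r"
    by (simp only: of_int_le_iff)
  obtain m a' b' where m: "0 < m"
    and child: "child_label i (a, b, c) = (a', b', if i = 3 then c + 1 else 0)"
    and ab: "(m * a', m * b') =
      [(2 * r - 3 * a, 3 * (r - a)), (r - a, r), (r, 3 * a), (a, b + 3 * a),
       (3 * a + b, 6 * a + 3 * b)] ! i"
    unfolding r_def
    by (rule child_label_up_to_factor[OF assms(2), where a = a and b = b and c = c])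
  have i: "i = 0 \<or> i = 1 \<or> i = 2 \<or> i = 3 \<or> i = 4"
    using assms(2) by linarith
  have "0 < m * a'" "0 < m * b'"
    using i ab \<open>0 < a\<close> \<open>0 < b\<close> \<open>3 * a \<le> r\<close> by auto
  then have pos: "0 < a'" "0 < b'"
    using m by (simp_all add: zero_less_mult_iff)
  have "label_ratio (child_label i L) = of_int (m * b') / of_int (m * a')"
    using m by (simp add: label_ratio_def L child del: child_label.simps)
  also have "\<dots> = branch i y"
  proof -
    have "(0 :: rat) < of_int a" "(0 :: rat) < of_int b" "3 * of_int a \<le> (of_int r :: rat)"
      using \<open>0 < a\<close> \<open>0 < b\<close> \<open>3 * a \<le> r\<close> by (simp_all flip: of_int_le_iff[where ?'a = rat])
    moreover obtain x z where xz: "m * a' = x" "m * b' = z"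
      by simp
    ultimately show ?thesis
      unfolding xz using i ab[unfolded xz]
      by (elim disjE) (simp_all add: branch_def refl[unfolded y] y divide_simps)
  qed
  finally have ratio: "label_ratio (child_label i L) = branch i y" .
  \<comment> \<open>Child 3 moves one cell up; the ranges of all other branches lie in the lowest cell, where the
    third component is 0.\<close>
  have "\<lceil>branch i y / 3\<rceil> = (if i = 3 then c + 1 else 0) + 1"
  proof (cases "i = 3")
    case True
    then show ?thesis
      using c by (simp add: branch_def add_divide_distrib)
  next
    case False
    then have "branch_of (branch i y) \<noteq> 3"
      using branch_of_branch[OF assms(2) \<open>0 < y\<close>] by simp
    then have "branch i y < 3"
      by (auto simp: branch_of_def split: if_splits)
    moreover have "0 < branch i y"
      using pos by (simp add: ratio[symmetric] label_ratio_def L child del: child_label.simps)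
    ultimately have "\<lceil>branch i y / 3\<rceil> = 1"
      by (intro ceiling_unique) simp_all
    then show ?thesis
      using False by simp
  qed
  then show ?thesis
    using ratio pos by (simp add: coherent_def L child y_def del: child_label.simps)
qed

definition vertex_ratio :: "nat \<Rightarrow> rat" where
  "vertex_ratio n = label_ratio (N_label n)"

lemma vertex_cases:
  fixes n :: nat
  assumes "1 \<le> n"
  obtains (root) "n = 1"
    | (child) k i where "1 \<le> k" "k < n" "i < 5" "n = 5 * k - 3 + i"
proof (cases "n = 1")
  case False
  define k where "k = (n + 3) div 5"
  define i where "i = (n + 3) mod 5"
  have "n + 3 = 5 * k + i" and "i < 5"
    by (simp_all add: k_def i_def)
  moreover from this have "1 \<le> k"
    using False assms by linarith
  ultimately show ?thesis
    using False assms by (intro child[of k i]) linarith+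
qed (rule root)

lemma coherent_N_label: "1 \<le> n \<Longrightarrow> coherent (N_label n)"
proof (induction n rule: less_induct)
  case (less n)
  from less.prems show ?case
  proof (cases rule: vertex_cases)
    case root
    show ?thesis
      unfolding root N_label_1 by (simp add: coherent_def label_ratio_def)
  next
    case (child k i)
    then show ?thesis
      using less.IH[of k] child_label_coherent by (simp only: N_label_child)
  qed
qed

lemma vertex_ratio_1: "vertex_ratio 1 = 3"
  unfolding vertex_ratio_def N_label_1 by (simp add: label_ratio_def)

lemma vertex_ratio_pos: "1 \<le> n \<Longrightarrow> 0 < vertex_ratio n"
  using coherent_N_label[of n]
  by (auto simp: vertex_ratio_def label_ratio_def coherent_def)

lemma vertex_ratio_child:
  assumes "1 \<le> n" and "i < 5"
  shows "vertex_ratio (5 * n - 3 + i) = branch i (vertex_ratio n)"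
  using child_label_coherent[OF coherent_N_label[OF assms(1)] assms(2)]
  unfolding vertex_ratio_def N_label_child[OF assms] by simp

lemma s_seq_eq_inverse: "1 \<le> n \<Longrightarrow> s_seq n = inverse (vertex_ratio n)"
  by (auto simp: s_seq_def vertex_ratio_def label_ratio_def split: prod.split)

section \<open>Every positive rational occurs exactly once\<close>

lemma vertex_ratio_inject:
  assumes "1 \<le> m" and "1 \<le> n" and "vertex_ratio m = vertex_ratio n"
  shows "m = n"
  using assms
proof (induction n arbitrary: m rule: less_induct)
  case (less n)
  have not_root: "vertex_ratio (5 * k - 3 + i) \<noteq> 3" if "1 \<le> k" "i < 5" for k i
    unfolding vertex_ratio_child[OF that]
    by (rule branch_neq_root[OF that(2) vertex_ratio_pos[OF that(1)]])
  from less.prems(2) show ?case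
  proof (cases rule: vertex_cases)
    case root
    from less.prems(1) show ?thesis
    proof (cases rule: vertex_cases)
      case root
      with \<open>n = 1\<close> show ?thesis by simp
    next
      case (child l j)
      then show ?thesis
        using not_root[of l j] less.prems(3) vertex_ratio_1 \<open>n = 1\<close> by simp
    qed
  next
    case n: (child k i)
    from less.prems(1) show ?thesis
    proof (cases rule: vertex_cases)
      case root
      then show ?thesis
        using not_root[of k i] less.prems(3) vertex_ratio_1 n by simp
    next
      case m: (child l j)
      have eq: "branch j (vertex_ratio l) = branch i (vertex_ratio k)"
        using less.prems(3) m n by (simp only: vertex_ratio_child)
      have "j = i"
        using eq branch_of_branch m n vertex_ratio_pos by metis
      moreover have "vertex_ratio l = vertex_ratio k"
        using eq parent_branch m n vertex_ratio_pos by metis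
      then have "l = k"
        using less.IH[of k l] m n by simp
      ultimately show ?thesis
        using m n by simp
    qed
  qed
qed

lemma occurs_if_parent_occurs:
  assumes "0 < y" and "parent y \<in> vertex_ratio ` {1..}"
  shows "y \<in> vertex_ratio ` {1..}"
proof -
  obtain k where k: "1 \<le> k" "vertex_ratio k = parent y"
    using assms(2) by auto
  have "vertex_ratio (5 * k - 3 + branch_of y) = y"
    using k branch_parent[OF assms(1)] by (metis vertex_ratio_child branch_of_less)
  moreover have "1 \<le> 5 * k - 3 + branch_of y"
    using k(1) by simp
  ultimately show ?thesis
    by (metis atLeast_iff imageI)
qed

lemma occurs_shift:
  assumes "0 < y" and "y \<in> vertex_ratio ` {1..}"
  shows "y + 3 * of_nat k \<in> vertex_ratio ` {1..}"
proof (induction k)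
  case 0
  show ?case
    using assms(2) by simp
next
  case (Suc k)
  have "parent (y + 3 * of_nat (Suc k)) = y + 3 * of_nat k"
    using assms(1) by (simp add: parent_def)
  moreover have "0 < y + 3 * of_nat (Suc k)"
    using assms(1) by (simp add: add_pos_nonneg)
  ultimately show ?case
    using occurs_if_parent_occurs Suc.IH by metis
qed

lemma has_weight_exists: "\<exists>w. has_weight y w"
proof -
  obtain p q where "quotient_of y = (p, q)"
    by (cases "quotient_of y")
  then show ?thesis
    using has_weight_plainI[of q y p] quotient_of_denom_pos[of y p q] quotient_of_div[of y p q]
    by auto
qed

lemma occurs_if_weight:
  assumes "0 < y" and "has_weight y w"
  shows "y \<in> vertex_ratio ` {1..}"
  using assms
proof (induction "nat w" arbitrary: y w rule: less_induct)
  case less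
  \<comment> \<open>Only the part of the descent below 3 lowers the weight; larger ratios are treated by a shift.\<close>
  have small: "z \<in> vertex_ratio ` {1..}" if z: "0 < z" "z \<le> 3" "has_weight z w" for z
  proof (cases "z = 3")
    case True
    then show ?thesis
      using vertex_ratio_1 by (metis atLeast_iff imageI order_refl)
  next
    case False
    then have "z < 3"
      using z by simp
    obtain w' where w': "has_weight (parent z) w'" "w' < w"
      using weight_parent_less z(3,1) \<open>z < 3\<close> by blast
    moreover have "0 < w"
      using z(3) by (auto simp: has_weight_def)
    ultimately have "parent z \<in> vertex_ratio ` {1..}"
      using less.hyps parent_pos[OF z(1) \<open>z < 3\<close>] by simp
    then show ?thesis
      using occurs_if_parent_occurs z(1) by blast
  qed
  define k where "k = nat (\<lceil>y / 3\<rceil> - 1)"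
  have "0 < \<lceil>y / 3\<rceil>"
    using less.prems(1) by simp
  define t :: rat where "t = of_int \<lceil>y / 3\<rceil>"
  have t: "t - 1 < y / 3" "y / 3 \<le> t"
    unfolding t_def using ceiling_correct[of "y / 3"] by blast+
  have k: "of_nat k = t - 1"
    using \<open>0 < \<lceil>y / 3\<rceil>\<close> by (simp add: k_def t_def of_nat_nat)
  define z where "z = y - 3 * of_nat k"
  have "0 < z" "z \<le> 3"
    using t by (simp_all add: z_def k)
  moreover have "has_weight z w"
    unfolding z_def using less.prems(2) by (rule has_weight_shift)
  ultimately have "z \<in> vertex_ratio ` {1..}"
    using small by blast
  then have "z + 3 * of_nat k \<in> vertex_ratio ` {1..}"
    using occurs_shift \<open>0 < z\<close> by blast
  then show ?case
    by (simp add: z_def)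
qed

lemma vertex_ratio_bij: "bij_betw vertex_ratio {1..} {0<..}"
proof (rule bij_betw_imageI)
  show "inj_on vertex_ratio {1..}"
    using vertex_ratio_inject by (auto intro!: inj_onI)
  show "vertex_ratio ` {1..} = {0<..}"
    using vertex_ratio_pos has_weight_exists occurs_if_weight by fastforce
qed

theorem theorem2:
  shows "bij_betw s_seq (UNIV :: nat set) {q :: rat. 0 \<le> q}"
proof -
  have "bij_betw inverse {0<..} {0 :: rat <..}"
    by (rule bij_betw_byWitness[where f' = inverse]) auto
  with vertex_ratio_bij have "bij_betw (inverse \<circ> vertex_ratio) {1..} {0<..}"
    by (rule bij_betw_trans)
  then have "bij_betw s_seq {1..} {0<..}"
    by (subst bij_betw_cong[where g = "inverse \<circ> vertex_ratio"]) (simp_all add: s_seq_eq_inverse)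
  moreover have "bij_betw s_seq {0} {0}"
    by (simp add: s_seq_def bij_betw_def)
  ultimately have "bij_betw s_seq ({0} \<union> {1..}) ({0} \<union> {0<..})"
    by (intro bij_betw_combine) auto
  moreover have "{0} \<union> {1..} = (UNIV :: nat set)"
    by auto
  moreover have "{0} \<union> {0<..} = {q :: rat. 0 \<le> q}"
    by auto
  ultimately show ?thesis
    by simp
qed

end
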